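(* Let $S=\{a_n\}_{n\in\mathbb N}$ be a sequence of complex numbers such that (i) $0<|a_1|\le|a_2|\le\dots\to\infty$ and (ii) the exponent of convergence $\alpha=\limsup_{n\to\infty}(\ln n)/(\ln|a_n|)$ is finite. Suppose that $\operatorname{Arg}(a_n)\ne\Psi$ for all $n$, where $\Psi\in[-\pi,\pi)$, and that the branch cut for $a\mapsto a^{-s}$ is chosen on the ray $R_\Psi=\{z=te^{i\Psi}:t\in[0,\infty)\}$. Let $\zeta_S(s)=\sum_{n=1}^\infty a_n^{-s}$, $\Re(s)>\alpha$, and let $$H(z)=\prod_{n=1}^{\infty}\left(1-\frac{z}{a_n}\right)\exp\left[\sum_{j=1}^{k-1}\frac1j\left(\frac{z}{a_n}\right)^j\right],\qquad k=\lfloor\alpha\rfloor+1 .$$ Assume that $\gamma$ is a contour contained in $\mathbb C\setminus\mathcal B_\delta$ for some sufficiently small $\delta>0$, where $\mathcal B_\delta=\bigcup_{n\in\mathbb N}\{z\in\mathbb C:|a_n-z|\le\delta|a_n|\}$, which avoids the branch cut $R_\Psi$ and encloses, in the counterclockwise direction, all the points of the sequence $S$. Then for $\Re(s)>\alpha$, $$\zeta_S(s)=\frac{1}{2\pi i}\int_\gamma dz\,z^{-s}\frac{d}{dz}\ln H(z).$$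
   Context: The series $\sum a_n^{-s}$ converges absolutely for $\Re(s)>\alpha$. The function $z^{-s}$ in the integral is defined with the same branch (cut along $R_\Psi$) as in $a_n^{-s}$. $H$ is entire with zeros exactly at the $a_n$ (with multiplicity), and $\frac{d}{dz}\ln H=H'/H$. The contour $\gamma$ is an unbounded contour of the following type: it comes in from infinity on one side of the ray $R_\Psi$, passes around the origin, and goes back to infinity on the other side of $R_\Psi$, so that $R_\Psi$ (including the origin) lies outside $\gamma$ and all points $a_n$ lie in the region it encloses.
   Formalization: The contour γ is additionally required to have arc length O(R) inside each disc |z| ≤ R (R ≥ 1); without such control, a contour whose end winds around a_n many times and then unwinds makes the integral diverge. *)

theory Defs
  imports "HOL-Complex_Analysis.Complex_Analysis"
begin

(* A sequence a_1, a_2, ... is represented by a :: nat => complex with a n standing for a_{n+1}. *)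

definition convergence_exponent :: "(nat \<Rightarrow> complex) \<Rightarrow> ereal" where
  "convergence_exponent a = limsup (\<lambda>n. ereal (ln (real (Suc n)) / ln (norm (a n))))"

(* The argument normalised to [-pi, pi); the library's Arg takes values in (-pi, pi]. *)
definition arg_co :: "complex \<Rightarrow> real" where
  "arg_co z = Arg2pi (- z) - pi"

definition cut_ray :: "real \<Rightarrow> complex set" where
  "cut_ray \<Psi> = {of_real t * cis \<Psi> | t. 0 \<le> t}"

(* Choosing the cut does not determine the logarithm completely: the branches differ by
   integer multiples of 2 pi i.  Any of them is admitted. *)
definition log_branch :: "real \<Rightarrow> (complex \<Rightarrow> complex) \<Rightarrow> bool" where
  "log_branch \<Psi> L \<longleftrightarrow> L holomorphic_on (- cut_ray \<Psi>) \<and> (\<forall>z \<in> - cut_ray \<Psi>. exp (L z) = z)"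

definition branch_power :: "(complex \<Rightarrow> complex) \<Rightarrow> complex \<Rightarrow> complex \<Rightarrow> complex" where
  "branch_power L z w = exp (w * L z)"

definition zeta_seq :: "(complex \<Rightarrow> complex) \<Rightarrow> (nat \<Rightarrow> complex) \<Rightarrow> complex \<Rightarrow> complex" where
  "zeta_seq L a s = (\<Sum>n. branch_power L (a n) (- s))"

definition canonical_product :: "nat \<Rightarrow> (nat \<Rightarrow> complex) \<Rightarrow> complex \<Rightarrow> complex" where
  "canonical_product k a z =
     (\<Prod>n. (1 - z / a n) * exp (\<Sum>j = 1..k - 1. 1 / of_nat j * (z / a n) ^ j))"

definition excluded_discs :: "real \<Rightarrow> (nat \<Rightarrow> complex) \<Rightarrow> complex set" where
  "excluded_discs \<delta> a = (\<Union>n. {z. norm (a n - z) \<le> \<delta> * norm (a n)})"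

(* Piecewise continuously differentiable curves from infinity to infinity, parametrised by the
   real line.  The last condition says that the curve has length O(R) inside the disc of radius R,
   as for curves that are eventually straight.  Without any such control an oscillating
   end of the curve can make integrals of decaying functions along it diverge. *)
definition unbounded_contour :: "(real \<Rightarrow> complex) \<Rightarrow> bool" where
  "unbounded_contour \<gamma> \<longleftrightarrow>
     (\<forall>a b. \<gamma> piecewise_C1_differentiable_on {a..b}) \<and>
     filterlim \<gamma> at_infinity at_bot \<and> filterlim \<gamma> at_infinity at_top \<and>
     (\<exists>C. \<forall>R\<ge>1. (\<lambda>t. norm (vector_derivative \<gamma> (at t))) integrable_on {t. norm (\<gamma> t) \<le> R} \<and>
        integral {t. norm (\<gamma> t) \<le> R} (\<lambda>t. norm (vector_derivative \<gamma> (at t))) \<le> C * R)"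

(* The piece of the curve over [-T, T], closed up from its final point to its initial point by a
   segment in the logarithmic coordinate.  For a curve avoiding the cut of L the closing arc does
   not cross the cut; if the modulus of the curve tends to infinity at both ends, the arc moves
   off to infinity with T. *)
definition closed_up :: "(complex \<Rightarrow> complex) \<Rightarrow> (real \<Rightarrow> complex) \<Rightarrow> real \<Rightarrow> real \<Rightarrow> complex" where
  "closed_up L \<gamma> T = subpath (- T) T \<gamma> +++ (exp \<circ> linepath (L (\<gamma> T)) (L (\<gamma> (- T))))"

(* w lies in the region enclosed by the unbounded curve, which goes round it once
   counterclockwise.  The cut itself is always outside (see winding_number_cut_ray below), so if a
   sequence tending to infinity is enclosed, the curve comes in from infinity on the side of the
   cut where the argument is larger, passes round the origin, and goes back on the other side. *)
definition encloses_ccw :: "(complex \<Rightarrow> complex) \<Rightarrow> (real \<Rightarrow> complex) \<Rightarrow> complex \<Rightarrow> bool" where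
  "encloses_ccw L \<gamma> w \<longleftrightarrow>
     (\<forall>\<^sub>F T in at_top. w \<notin> path_image (closed_up L \<gamma> T) \<and> winding_number (closed_up L \<gamma> T) w = 1)"

definition has_line_integral ::
    "(complex \<Rightarrow> complex) \<Rightarrow> complex \<Rightarrow> (real \<Rightarrow> complex) \<Rightarrow> bool" where
  "has_line_integral f I \<gamma> \<longleftrightarrow>
     ((\<lambda>t. f (\<gamma> t) * vector_derivative \<gamma> (at t)) has_integral I) UNIV"

lemma arg_co_bounds: "- pi \<le> arg_co z" "arg_co z < pi"
  using Arg2pi[of "- z"] by (auto simp: arg_co_def)

lemma arg_co_eq: "z = of_real (norm z) * cis (arg_co z)"
proof -
  have "- z = of_real (norm z) * cis (Arg2pi (- z))"
    using Arg2pi[of "- z"] by (simp add: is_Arg_def cis_conv_exp)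
  moreover have "cis (arg_co z) = - cis (Arg2pi (- z))"
    by (simp add: arg_co_def complex_eq_iff)
  ultimately show ?thesis by (metis minus_mult_right minus_minus)
qed

lemma cut_ray_iff: "z \<in> cut_ray \<Psi> \<longleftrightarrow> - z * cis (- \<Psi>) \<in> \<real>\<^sub>\<le>\<^sub>0"
proof
  assume "z \<in> cut_ray \<Psi>"
  then obtain t where t: "0 \<le> t" "z = of_real t * cis \<Psi>" by (auto simp: cut_ray_def)
  have "- z * cis (- \<Psi>) = of_real (- t)"
    using t by (simp add: mult.assoc cis_mult)
  also have "\<dots> \<in> \<real>\<^sub>\<le>\<^sub>0" using t(1) by (simp del: of_real_minus)
  finally show "- z * cis (- \<Psi>) \<in> \<real>\<^sub>\<le>\<^sub>0" .
next
  assume "- z * cis (- \<Psi>) \<in> \<real>\<^sub>\<le>\<^sub>0"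
  then obtain r where r: "r \<le> 0" "- z * cis (- \<Psi>) = of_real r" by (metis nonpos_Reals_cases)
  have "z = - (- z * cis (- \<Psi>)) * cis \<Psi>" by (simp add: cis_mult mult.assoc)
  hence "z = of_real (- r) * cis \<Psi>" unfolding r(2) by simp
  thus "z \<in> cut_ray \<Psi>" unfolding cut_ray_def using r by (intro CollectI exI[of _ "- r"]) auto
qed

lemma log_branch_Im_bounds:
  assumes "log_branch \<Psi> L"
  obtains \<theta> where "cis \<theta> = - cis \<Psi>"
    "\<And>z. z \<notin> cut_ray \<Psi> \<Longrightarrow> \<theta> - pi < Im (L z) \<and> Im (L z) < \<theta> + pi"
proof -
  define m where "m z = - z * cis (- \<Psi>)" for z
  define f where "f z = (L z - Ln (m z) - \<i> * of_real (\<Psi> + pi)) / (2 * of_real pi * \<i>)" for z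
  have mcut: "m z \<notin> \<real>\<^sub>\<le>\<^sub>0" if "z \<notin> cut_ray \<Psi>" for z
    using that by (simp add: cut_ray_iff m_def)
  have int: "f z \<in> \<int>" if z: "z \<notin> cut_ray \<Psi>" for z
  proof -
    have "m z \<noteq> 0" using mcut[OF z] by auto
    have "exp (L z) = exp (Ln (m z) + \<i> * of_real (\<Psi> + pi))"
    proof -
      have "exp (Ln (m z) + \<i> * of_real (\<Psi> + pi)) = m z * cis (\<Psi> + pi)"
        using \<open>m z \<noteq> 0\<close> by (simp add: exp_add cis_conv_exp)
      also have "\<dots> = z" by (simp add: m_def cis_mult mult.assoc)
      finally show ?thesis using assms z by (simp add: log_branch_def)
    qed
    then obtain n :: int where "L z = Ln (m z) + \<i> * of_real (\<Psi> + pi) + of_int (2 * n) * pi * \<i>"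
      by (auto simp: exp_eq)
    hence "f z = of_int n" by (simp add: f_def field_simps)
    thus ?thesis by simp
  qed
  have conn: "connected (- cut_ray \<Psi>)"
  proof -
    have "- cut_ray \<Psi> = (\<lambda>z. - z * cis \<Psi>) ` (- \<real>\<^sub>\<le>\<^sub>0)"
    proof (intro equalityI subsetI)
      fix z assume "z \<in> - cut_ray \<Psi>"
      thus "z \<in> (\<lambda>z. - z * cis \<Psi>) ` (- \<real>\<^sub>\<le>\<^sub>0)"
        by (intro image_eqI[of _ _ "- z * cis (- \<Psi>)"]) (auto simp: cut_ray_iff cis_mult mult.assoc)
    qed (auto simp: cut_ray_iff cis_mult mult.assoc)
    moreover have "connected (- \<real>\<^sub>\<le>\<^sub>0 :: complex set)"
    proof -
      have "\<real>\<^sub>\<le>\<^sub>0 = complex_of_real ` {..0}" by (auto simp: nonpos_Reals_def)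
      thus ?thesis by (metis starlike_imp_connected starlike_slotted_complex_plane_left)
    qed
    ultimately show ?thesis by (auto intro!: connected_continuous_image continuous_intros)
  qed
  have contL: "continuous_on (- cut_ray \<Psi>) L"
    using assms by (auto simp: log_branch_def intro: holomorphic_on_imp_continuous_on)
  have contm: "continuous_on (- cut_ray \<Psi>) m"
    unfolding m_def by (intro continuous_intros)
  have "continuous_on (- cut_ray \<Psi>) (\<lambda>z. Ln (m z))"
    using mcut contm by (auto intro!: continuous_intros)
  hence cont: "continuous_on (- cut_ray \<Psi>) f"
    unfolding f_def using contL contm mcut by (auto intro!: continuous_intros)
  have "f constant_on (- cut_ray \<Psi>)"
  proof (rule continuous_discrete_range_constant[OF conn cont])
    fix x assume x: "x \<in> - cut_ray \<Psi>"
    show "\<exists>e>0. \<forall>y. y \<in> - cut_ray \<Psi> \<and> f y \<noteq> f x \<longrightarrow> e \<le> norm (f y - f x)"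
    proof (intro exI[of _ 1] conjI allI impI)
      fix y assume y: "y \<in> - cut_ray \<Psi> \<and> f y \<noteq> f x"
      have "f y - f x \<in> \<int>" using x y int by auto
      then obtain n where n: "f y - f x = of_int n" by (auto elim: Ints_cases)
      with y have "n \<noteq> 0" by auto
      thus "1 \<le> norm (f y - f x)" unfolding n norm_of_int by linarith
    qed simp
  qed
  then obtain c where c: "\<And>z. z \<notin> cut_ray \<Psi> \<Longrightarrow> f z = c"
    by (auto simp: constant_on_def)
  obtain z0 where z0: "z0 \<notin> cut_ray \<Psi>"
    by (rule that[of "- cis \<Psi>"]) (simp add: cut_ray_iff cis_mult)
  obtain n where n: "c = of_int n" using int[OF z0] c[OF z0] by (auto elim: Ints_cases)
  have Leq: "L z = Ln (m z) + \<i> * of_real (\<Psi> + pi + 2 * pi * of_int n)" if "z \<notin> cut_ray \<Psi>" for z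
    using c[OF that] by (simp add: f_def n field_simps)
  show thesis
  proof (rule that[of "\<Psi> + pi + 2 * pi * of_int n"])
    show "cis (\<Psi> + pi + 2 * pi * of_int n) = - cis \<Psi>"
      by (simp flip: cis_mult)
    fix z assume z: "z \<notin> cut_ray \<Psi>"
    have "m z \<noteq> 0" using mcut[OF z] by auto
    moreover have "Im (Ln (m z)) \<noteq> pi"
      using mcut[OF z] \<open>m z \<noteq> 0\<close> by (metis Im_Ln_eq_pi complex_nonpos_Reals_iff less_imp_le)
    ultimately have "- pi < Im (Ln (m z))" "Im (Ln (m z)) < pi"
      using mpi_less_Im_Ln[of "m z"] Im_Ln_le_pi[of "m z"] by auto
    thus "\<Psi> + pi + 2 * pi * of_int n - pi < Im (L z) \<and> Im (L z) < \<Psi> + pi + 2 * pi * of_int n + pi"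
      by (simp add: Leq[OF z])
  qed
qed

lemma winding_number_cut_ray:
  assumes L: "log_branch \<Psi> L" and \<gamma>: "continuous_on UNIV \<gamma>" "range \<gamma> \<inter> cut_ray \<Psi> = {}"
    and w: "w \<in> cut_ray \<Psi>"
  shows "winding_number (closed_up L \<gamma> T) w = 0"
proof (rule winding_number_zero_in_outside)
  obtain \<theta> where \<theta>: "cis \<theta> = - cis \<Psi>"
    "\<And>z. z \<notin> cut_ray \<Psi> \<Longrightarrow> \<theta> - pi < Im (L z) \<and> Im (L z) < \<theta> + pi"
    using log_branch_Im_bounds[OF L] by blast
  have off: "\<gamma> t \<notin> cut_ray \<Psi>" for t using \<gamma> by blast
  have eL: "exp (L (\<gamma> t)) = \<gamma> t" for t using L off by (simp add: log_branch_def)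
  have segment: "exp u \<notin> cut_ray \<Psi>" if u: "\<theta> - pi < Im u" "Im u < \<theta> + pi" for u
  proof
    assume "exp u \<in> cut_ray \<Psi>"
    moreover have "- exp u * cis (- \<Psi>) = exp (u - \<i> * of_real \<theta>)"
    proof -
      have "cis (- \<theta>) = - cis (- \<Psi>)" using \<theta>(1) by (metis cis_cnj complex_cnj_minus)
      thus ?thesis by (simp add: exp_diff cis_conv_exp exp_minus field_simps)
    qed
    ultimately have "exp (u - \<i> * of_real \<theta>) \<in> \<real>\<^sub>\<le>\<^sub>0" by (metis cut_ray_iff)
    moreover have "Ln (exp (u - \<i> * of_real \<theta>)) = u - \<i> * of_real \<theta>"
      using u by (intro Ln_exp) auto
    moreover have "Im (Ln v) = pi" if "v \<in> \<real>\<^sub>\<le>\<^sub>0" "v \<noteq> 0" for v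
      using that Im_Ln_eq_pi[of v] by (auto simp: complex_nonpos_Reals_iff complex_eq_iff)
    ultimately have "Im (u - \<i> * of_real \<theta>) = pi"
      by (metis exp_not_eq_zero)
    thus False using u by simp
  qed
  have sub: "path (subpath (- T) T \<gamma>)"
    unfolding subpath_def path_def
    by (intro continuous_on_compose2[OF \<gamma>(1)] continuous_intros) auto
  show "path (closed_up L \<gamma> T)"
    unfolding closed_up_def using sub
    by (intro path_join_imp path_continuous_image path_linepath)
       (auto simp: pathstart_def pathfinish_def subpath_def eL linepath_def intro!: continuous_intros)
  show "pathfinish (closed_up L \<gamma> T) = pathstart (closed_up L \<gamma> T)"
    by (simp add: closed_up_def joinpaths_def pathstart_def pathfinish_def subpath_def linepath_def eL)
  have "path_image (closed_up L \<gamma> T) \<inter> cut_ray \<Psi> = {}"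
  proof -
    have "exp u \<notin> cut_ray \<Psi>" if "u \<in> closed_segment (L (\<gamma> T)) (L (\<gamma> (- T)))" for u
    proof -
      have "convex {u. \<theta> - pi < Im u \<and> Im u < \<theta> + pi}"
        by (auto simp: Collect_conj_eq intro!: convex_Int convex_halfspace_Im_gt convex_halfspace_Im_lt)
      hence "closed_segment (L (\<gamma> T)) (L (\<gamma> (- T))) \<subseteq> {u. \<theta> - pi < Im u \<and> Im u < \<theta> + pi}"
        by (intro closed_segment_subset) (use \<theta>(2) off in auto)
      thus ?thesis using that segment by blast
    qed
    moreover have "path_image (subpath (- T) T \<gamma>) \<subseteq> range \<gamma>"
      by (auto simp: path_image_def subpath_def)
    moreover have "path_image (closed_up L \<gamma> T) \<subseteq>
        path_image (subpath (- T) T \<gamma>) \<union> exp ` closed_segment (L (\<gamma> T)) (L (\<gamma> (- T)))"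
      unfolding closed_up_def using path_image_join_subset
      by (metis path_image_compose path_image_linepath)
    ultimately show ?thesis using \<gamma>(2) by blast
  qed
  moreover have "connected (cut_ray \<Psi>)"
  proof -
    have "cut_ray \<Psi> = (\<lambda>t. of_real t * cis \<Psi>) ` {0..}" by (auto simp: cut_ray_def)
    thus ?thesis by (auto intro!: connected_continuous_image continuous_intros)
  qed
  ultimately have "cut_ray \<Psi> \<subseteq> connected_component_set (- path_image (closed_up L \<gamma> T)) w"
    using w by (intro connected_component_maximal) auto
  moreover have "\<not> bounded (cut_ray \<Psi>)"
  proof
    assume "bounded (cut_ray \<Psi>)"
    then obtain B where B: "\<And>z. z \<in> cut_ray \<Psi> \<Longrightarrow> norm z \<le> B" by (auto simp: bounded_iff)
    have "of_real (\<bar>B\<bar> + 1) * cis \<Psi> \<in> cut_ray \<Psi>"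
      unfolding cut_ray_def by (intro CollectI exI[of _ "\<bar>B\<bar> + 1"]) auto
    from B[OF this] show False by (simp add: norm_mult del: of_real_add)
  qed
  ultimately show "w \<in> outside (path_image (closed_up L \<gamma> T))"
    using w \<open>path_image (closed_up L \<gamma> T) \<inter> cut_ray \<Psi> = {}\<close>
    by (auto simp: outside_def dest: bounded_subset)
qed

end

theory Submission
  imports Defs
begin

text \<open>
  Let \<open>m = \<lfloor>\<alpha>\<rfloor>\<close>, so that \<open>k = m + 1\<close>.  Differentiating the logarithm of one factor of the product gives
  a finite geometric sum, which collapses the pole and its compensating polynomial into one term:
  \<open>H' z / H z = (\<Sum>n. (z / a n) ^ m / (z - a n))\<close> (\<open>logderiv_canonical_product\<close>).  After multiplication by
  \<open>z\<^sup>-\<^sup>s\<close> the \<open>n\<close>-th term has a single simple pole off the cut, at \<open>a n\<close>, with residue \<open>(a n)\<^sup>-\<^sup>s\<close>.  So the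
  theorem says that the residues may be evaluated term by term along an infinite contour.

  Both limits involved, the contour going to infinity and the sum over \<open>n\<close>, are controlled by one
  estimate.  Choose \<open>p\<close> with \<open>\<alpha> < p < min (Re s) (m + 1)\<close>.  Outside the disc around \<open>a n\<close> the distance
  \<open>\<bar>z - a n\<bar>\<close> dominates, up to a constant, both \<open>\<bar>z\<bar>\<close> and \<open>\<bar>a n\<bar>\<close>, hence any weighted geometric mean
  of the two, and the weights can be chosen such that the \<open>n\<close>-th term is at most a constant times
  \<open>\<bar>a n\<bar> powr (- p) * \<bar>z\<bar> powr (p - 1)\<close> (\<open>norm_term_le\<close>).  On the cut plane \<open>z\<^sup>-\<^sup>s\<close> is
  \<open>O(\<bar>z\<bar> powr (- Re s))\<close>, because the imaginary part of a branch of the logarithm is bounded there.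
  With \<open>\<epsilon> = Re s - p > 0\<close> the integrand is therefore \<open>O(\<bar>a n\<bar> powr (- p) * \<bar>z\<bar> powr (- 1 - \<epsilon>))\<close>.

  The exponent \<open>- 1 - \<epsilon>\<close> is integrable along the contour, since its length inside the disc of radius \<open>R\<close>
  is \<open>O(R)\<close> (\<open>unbounded_contour_integrable_powr\<close>), and in the logarithmic coordinate it makes the closing
  arcs contribute \<open>O(\<bar>z\<bar> powr (- \<epsilon>))\<close> at their endpoints (\<open>log_segment_integral_le\<close>).  Cauchy's formula
  for the closed-up curves, which wind once round \<open>a n\<close> and not at all round the cut, thus passes to
  the limit (\<open>Cauchy_integral_formula_unbounded_contour\<close>).  The series \<open>\<Sum>n. \<bar>a n\<bar> powr (- p)\<close> converges as \<open>p\<close>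
  exceeds the exponent of convergence, and dominated convergence allows the summation over \<open>n\<close>.
\<close>

section \<open>The exponent of convergence\<close>

lemma convergence_exponent_nonneg:
  assumes lim: "filterlim (\<lambda>n. norm (a n)) at_top sequentially"
  shows "0 \<le> convergence_exponent a"
proof -
  have "\<forall>\<^sub>F n in sequentially. 1 \<le> norm (a n)"
    using lim by (simp add: filterlim_at_top)
  hence "\<forall>\<^sub>F n in sequentially. (0::ereal) \<le> ereal (ln (real (Suc n)) / ln (norm (a n)))"
    by eventually_elim simp
  hence "(0::ereal) \<le> liminf (\<lambda>n. ereal (ln (real (Suc n)) / ln (norm (a n))))"
    by (rule Liminf_bounded)
  also have "\<dots> \<le> convergence_exponent a"
    unfolding convergence_exponent_def by (intro Liminf_le_Limsup) simp
  finally show ?thesis .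
qed

text \<open>
  With \<open>q\<close> strictly between the exponent and \<open>p\<close>, eventually \<open>n + 1 < \<bar>a n\<bar> powr q\<close>, so the terms are
  dominated by \<open>(n + 1) powr (- p / q)\<close>, and \<open>p / q > 1\<close>.
\<close>
lemma summable_norm_powr_convergence_exponent:
  assumes lim: "filterlim (\<lambda>n. norm (a n)) at_top sequentially"
    and less: "convergence_exponent a < ereal p"
  shows "summable (\<lambda>n. norm (a n) powr (- p))"
proof -
  obtain q where q: "convergence_exponent a < ereal q" "q < p"
    using less ereal_dense2 by (metis ereal_less(2) less_ereal.simps(1))
  have q0: "0 < q"
    using convergence_exponent_nonneg[OF lim] q(1) by (metis ereal_less(2) le_less_trans)
  have "\<forall>\<^sub>F n in sequentially. ereal (ln (real (Suc n)) / ln (norm (a n))) < ereal q"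
    using q(1) unfolding convergence_exponent_def by (rule Limsup_lessD)
  moreover have "\<forall>\<^sub>F n in sequentially. 1 < norm (a n)"
    using lim by (simp add: filterlim_at_top_dense)
  ultimately have "\<forall>\<^sub>F n in sequentially. norm (norm (a n) powr (- p)) \<le> real (Suc n) powr (- (p / q))"
  proof eventually_elim
    case (elim n)
    have "0 < ln (norm (a n))" using elim(2) by (rule ln_gt_zero)
    hence "ln (real (Suc n)) < q * ln (norm (a n))"
      using elim by (simp add: pos_divide_less_eq del: of_nat_Suc)
    hence "(p / q) * ln (real (Suc n)) \<le> (p / q) * (q * ln (norm (a n)))"
      using q0 q(2) by (intro mult_left_mono) auto
    hence "- p * ln (norm (a n)) \<le> - (p / q) * ln (real (Suc n))"
      using q0 by simp
    moreover have "a n \<noteq> 0" using elim by auto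
    ultimately show ?case by (simp add: powr_def)
  qed
  moreover have "summable (\<lambda>n. real (Suc n) powr (- (p / q)))"
    using q q0 by (subst summable_Suc_iff) (simp add: summable_real_powr_iff)
  ultimately show ?thesis by (rule summable_comparison_test_ev)
qed

section \<open>The logarithmic derivative of the canonical product\<close>

text \<open>
  The derivative of the exponent is the geometric sum \<open>\<Sum>j<m. (z / w) ^ j / w\<close>, which equals
  \<open>(1 - (z / w) ^ m) / (w - z)\<close>.  Its part \<open>1 / (w - z)\<close> cancels the logarithmic derivative \<open>1 / (z - w)\<close>
  of the linear factor.
\<close>
lemma logderiv_weierstrass_factor:
  assumes "w \<noteq> 0" "z \<noteq> w"
  shows "deriv (\<lambda>z. weierstrass_factor m (z / w)) z / weierstrass_factor m (z / w) = (z / w) ^ m / (z - w)"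
proof -
  define Q where "Q z = (\<Sum>k=1..m. (z / w) ^ k / of_nat k)" for z
  let ?u = "z / w"
  have u: "?u \<noteq> 1" using assms by simp
  have "(Q has_field_derivative (\<Sum>k=1..m. ?u ^ (k - 1) / w)) (at z)"
    unfolding Q_def
  proof (rule DERIV_sum)
    fix k assume "k \<in> {1..m}"
    then obtain j where "k = Suc j" by (cases k) auto
    thus "((\<lambda>z. (z / w) ^ k / of_nat k) has_field_derivative ?u ^ (k - 1) / w) (at z)"
      using DERIV_cdivide[OF DERIV_power_Suc[OF DERIV_cdivide[OF DERIV_ident[of "at z"], of w], of j], of "of_nat k"]
      unfolding of_nat_Suc[symmetric] by (simp del: of_nat_Suc)
  qed
  moreover have "(\<Sum>k=1..m. ?u ^ (k - 1) / w) = (1 - ?u ^ m) / (1 - ?u) / w"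
  proof -
    have "(\<Sum>k=1..m. ?u ^ (k - 1)) = (\<Sum>k<m. ?u ^ k)"
      by (rule sum.reindex_bij_witness[of _ Suc "\<lambda>k. k - 1"]) auto
    moreover have "(\<Sum>k<m. ?u ^ k) = (1 - ?u ^ m) / (1 - ?u)"
      unfolding sum_gp_strict using u by presburger
    ultimately show ?thesis by (simp flip: sum_divide_distrib)
  qed
  ultimately have "(Q has_field_derivative (1 - ?u ^ m) / (1 - ?u) / w) (at z)"
    by simp
  hence "((\<lambda>z. (1 - z / w) * exp (Q z)) has_field_derivative
      (1 - ?u) * (exp (Q z) * ((1 - ?u ^ m) / (1 - ?u) / w)) - exp (Q z) / w) (at z)"
    using assms by (auto intro!: derivative_eq_intros)
  hence "deriv (\<lambda>z. weierstrass_factor m (z / w)) z =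
      (1 - ?u) * (exp (Q z) * ((1 - ?u ^ m) / (1 - ?u) / w)) - exp (Q z) / w"
    unfolding weierstrass_factor_def Q_def by (rule DERIV_imp_deriv)
  also have "\<dots> = - exp (Q z) * (?u ^ m / w)"
  proof -
    have "(1 - ?u) * (exp (Q z) * ((1 - ?u ^ m) / (1 - ?u) / w)) = exp (Q z) * ((1 - ?u ^ m) / w)"
      using u by simp
    thus ?thesis by (simp add: diff_divide_distrib right_diff_distrib del: power_divide)
  qed
  finally have "deriv (\<lambda>z. weierstrass_factor m (z / w)) z / weierstrass_factor m (z / w) = - (?u ^ m / w) / (1 - ?u)"
    by (simp add: weierstrass_factor_def Q_def)
  also have "\<dots> = ?u ^ m / (z - w)"
  proof -
    have "z - w = - (w * (1 - ?u))" using assms(1) by (simp add: algebra_simps)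
    thus ?thesis by (simp del: power_divide)
  qed
  finally show ?thesis .
qed

text \<open>
  Locally uniform convergence of the product allows the logarithmic derivative to be taken factor by
  factor.  The summability hypothesis is what the factors with exponent polynomial of degree \<open>m\<close>, which
  are \<open>1 + O((z / a n) ^ (m + 1))\<close>, need for that.
\<close>
lemma logderiv_canonical_product:
  assumes nz: "\<And>n. a n \<noteq> 0" and lim: "filterlim (\<lambda>n. norm (a n)) at_top sequentially"
    and sum: "summable (\<lambda>n. norm (a n) powr (- real (Suc m)))" and z: "z \<notin> range a"
  shows "(\<lambda>n. (z / a n) ^ m / (z - a n)) sums
           (deriv (canonical_product (Suc m) a) z / canonical_product (Suc m) a z)"
proof -
  interpret weierstrass_product a "\<lambda>_. m"
  proof
    show "filterlim a at_infinity sequentially"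
      using lim by (rule filterlim_norm_at_top_imp_at_infinity)
    fix r :: real assume "r > 0"
    have eq: "(r / norm (a n)) ^ Suc m = r ^ Suc m * norm (a n) powr (- real (Suc m))" for n
      using nz[of n] by (simp add: powr_minus powr_realpow divide_inverse power_mult_distrib
          power_inverse del: power_Suc of_nat_Suc)
    show "summable (\<lambda>n. (r / norm (a n)) ^ Suc m)"
      unfolding eq using sum by (rule summable_mult)
  qed (fact nz)
  have "canonical_product (Suc m) a = f"
    by (simp add: fun_eq_iff canonical_product_def f_def weierstrass_factor_def)
  moreover have "(\<lambda>n. deriv (\<lambda>z. weierstrass_factor m (z / a n)) z / weierstrass_factor m (z / a n))
      sums (deriv f z / f z)"
  proof (rule logderiv_prodinf_complex_uniform_limit)
    show "uniform_limit (ball 0 (norm z + 1)) (\<lambda>n z. \<Prod>k<n. weierstrass_factor m (z / a k)) f sequentially"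
      by (rule uniform_limit_on_subset[OF uniform_limit[of "norm z + 1"]]) (auto intro: add_nonneg_pos)
    show "f z \<noteq> 0" using z zero by simp
  qed (auto intro!: holomorphic_intros simp: nz)
  moreover have "z \<noteq> a n" for n using z by blast
  ultimately show ?thesis
    using nz by (simp add: logderiv_weierstrass_factor)
qed

text \<open>
  The hypothesis on \<open>\<delta>\<close> makes \<open>\<bar>z - w\<bar>\<close> comparable with \<open>max \<bar>z\<bar> \<bar>w\<bar>\<close>, which is at least every weighted
  geometric mean of \<open>\<bar>z\<bar>\<close> and \<open>\<bar>w\<bar>\<close>.  The weights trade decay in \<open>z\<close> against decay in \<open>w\<close>: the exponent
  \<open>p\<close> may be anywhere in \<open>[m, m + 1]\<close>, so it can be put between the exponent of convergence of a
  sequence of points \<open>w\<close> and the real part of \<open>s\<close>.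
\<close>
lemma norm_term_le:
  fixes z w :: complex
  assumes "0 < \<delta>" "\<delta> * norm w \<le> norm (z - w)" "w \<noteq> 0" "z \<noteq> 0" "real m \<le> p" "p \<le> real m + 1"
  shows "norm ((z / w) ^ m / (z - w)) \<le> (1 + 2 / \<delta>) * norm w powr (- p) * norm z powr (p - 1)"
proof -
  define x y d where "x = norm z" and "y = norm w" and "d = norm (z - w)"
  have pos: "x > 0" "y > 0" using assms by (auto simp: x_def y_def)
  have d: "\<delta> * y \<le> d" using assms by (simp add: y_def d_def)
  hence d0: "d > 0" using mult_pos_pos[OF assms(1) pos(2)] by linarith
  have "y \<le> d / \<delta>" using d assms(1) by (simp add: field_simps)
  have "x \<le> d + y" unfolding x_def d_def y_def using norm_triangle_sub by (metis add.commute)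
  have sum: "max x y \<le> (1 + 2 / \<delta>) * d" 
  proof -
    have "(1 + 2 / \<delta>) * d = d + 2 * (d / \<delta>)" by (simp add: distrib_right)
    moreover have "0 \<le> d / \<delta>" using d0 assms(1) by simp
    ultimately show ?thesis using \<open>y \<le> d / \<delta>\<close> \<open>x \<le> d + y\<close> d0 by linarith
  qed
  \<comment> \<open>the weights \<open>m + 1 - p\<close> and \<open>p - m\<close> are nonnegative and add up to 1\<close>
  have "x powr (m + 1 - p) * y powr (p - m) \<le> max x y powr (m + 1 - p) * max x y powr (p - m)"
    using assms pos by (intro mult_mono powr_mono2) auto
  also have "\<dots> = max x y" using pos by (simp flip: powr_add)
  finally have key: "x powr (m + 1 - p) * y powr (p - m) \<le> (1 + 2 / \<delta>) * d" using sum by linarith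
  have "norm ((z / w) ^ m / (z - w)) = x powr m * y powr (- real m) / d"
    using pos by (simp add: norm_divide norm_power powr_minus powr_realpow x_def y_def d_def power_divide)
        (simp add: divide_inverse norm_mult norm_power)
  also have "\<dots> = (x powr (m + 1 - p) * y powr (p - m)) * (y powr (- p) * x powr (p - 1)) / d"
  proof -
    have "x powr m = x powr (m + 1 - p) * x powr (p - 1)"
         "y powr (- real m) = y powr (p - m) * y powr (- p)" by (simp_all flip: powr_add)
    thus ?thesis by simp
  qed
  also have "\<dots> \<le> ((1 + 2 / \<delta>) * d) * (y powr (- p) * x powr (p - 1)) / d"
    using key d0 by (intro divide_right_mono mult_right_mono) auto
  also have "\<dots> = (1 + 2 / \<delta>) * y powr (- p) * x powr (p - 1)" using d0 by simp
  finally show ?thesis by (simp add: x_def y_def)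
qed

section \<open>The cut plane and the branch of the logarithm\<close>

lemma zero_in_cut_ray: "0 \<in> cut_ray \<Psi>"
  unfolding cut_ray_def by (intro CollectI exI[of _ 0]) simp

lemma closed_cut_ray: "closed (cut_ray \<Psi>)"
proof -
  have "cut_ray \<Psi> = (\<lambda>z. - z * cis (- \<Psi>)) -` \<real>\<^sub>\<le>\<^sub>0"
    by (auto simp: cut_ray_iff)
  thus ?thesis
    by (auto intro!: closed_vimage continuous_intros)
qed

lemma not_in_cut_ray:
  assumes "- pi \<le> \<Psi>" "\<Psi> < pi" "z \<noteq> 0" "arg_co z \<noteq> \<Psi>"
  shows "z \<notin> cut_ray \<Psi>"
proof
  assume "z \<in> cut_ray \<Psi>"
  then obtain t where t: "0 \<le> t" "z = of_real t * cis \<Psi>" by (auto simp: cut_ray_def)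
  hence "0 < t" using assms by (cases "t = 0") auto
  moreover have "of_real t * exp (\<i> * of_real (\<Psi> + pi)) = - z"
    using t by (simp add: distrib_left exp_add cis_conv_exp)
  ultimately have "Arg2pi (- z) = \<Psi> + pi"
    using assms by (intro Arg2pi_unique[of t]) auto
  thus False using assms by (simp add: arg_co_def)
qed

text \<open>
  \<open>\<bar>z\<^sup>-\<^sup>s\<bar> = \<bar>z\<bar> powr (- Re s) * exp (Im s * Im (L z))\<close>, and the imaginary part of \<open>L\<close> stays in an interval
  of length \<open>2 * pi\<close>.
\<close>
lemma norm_branch_power_le:
  assumes "log_branch \<Psi> L"
  obtains B where "0 \<le> B" "\<And>z. z \<notin> cut_ray \<Psi> \<Longrightarrow> norm (branch_power L z (- s)) \<le> B * norm z powr (- Re s)"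
proof -
  obtain \<theta> where \<theta>: "\<And>z. z \<notin> cut_ray \<Psi> \<Longrightarrow> \<theta> - pi < Im (L z) \<and> Im (L z) < \<theta> + pi"
    using log_branch_Im_bounds[OF assms] by metis
  show thesis
  proof (rule that[of "exp (\<bar>Im s\<bar> * (\<bar>\<theta>\<bar> + pi))"])
    show "0 \<le> exp (\<bar>Im s\<bar> * (\<bar>\<theta>\<bar> + pi))" by simp
    fix z assume z: "z \<notin> cut_ray \<Psi>"
    have eL: "exp (L z) = z" using assms z by (simp add: log_branch_def)
    hence "norm z = exp (Re (L z))" by (metis norm_exp_eq_Re)
    hence Re: "norm z powr (- Re s) = exp (- Re s * Re (L z))" by (simp add: powr_def)
    have "Im s * Im (L z) \<le> \<bar>Im s\<bar> * \<bar>Im (L z)\<bar>" by (metis abs_ge_self abs_mult)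
    also have "\<dots> \<le> \<bar>Im s\<bar> * (\<bar>\<theta>\<bar> + pi)" using \<theta>[OF z] by (intro mult_left_mono) auto
    finally show "norm (branch_power L z (- s)) \<le> exp (\<bar>Im s\<bar> * (\<bar>\<theta>\<bar> + pi)) * norm z powr (- Re s)"
      by (simp add: branch_power_def Re flip: exp_add)
  qed
qed

text \<open>
  The direction of the cut corresponds to the imaginary parts \<open>\<theta> + pi\<close> modulo \<open>2 * pi\<close>, and none of
  these lies strictly between the edges of the strip.
\<close>
lemma exp_notin_cut_ray:
  assumes "cis \<theta> = - cis \<Psi>" "\<theta> - pi < Im u" "Im u < \<theta> + pi"
  shows "exp u \<notin> cut_ray \<Psi>"
proof
  assume "exp u \<in> cut_ray \<Psi>"
  then obtain t where t: "0 \<le> t" "exp u = of_real t * cis \<Psi>" by (auto simp: cut_ray_def)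
  have "norm (exp u) = t" unfolding t(2) using t(1) by (simp add: norm_mult)
  hence e: "t = exp (Re u)" by simp
  have "of_real t * cis (Im u) = of_real t * (- cis \<theta>)"
    using t(2) assms(1) unfolding e by (simp add: exp_eq_polar)
  moreover have "t \<noteq> 0" unfolding e by simp
  ultimately have "cis (Im u) = - cis \<theta>" by (metis mult_left_cancel of_real_eq_0_iff)
  hence "cis (Im u - \<theta>) = - 1" by (simp flip: cis_divide)
  hence "cos (Im u - \<theta>) = - 1" by (metis cis.sel(1) one_complex.sel(1) uminus_complex.sel(1))
  thus False using cos_gt_neg1[of "Im u - \<theta>"] assms by simp
qed

text \<open>
  Both logarithms lie in the same open strip of width \<open>2 * pi\<close>, which is convex and is mapped off the cut
  by \<open>exp\<close>.
\<close>
lemma closing_arc_avoids_cut: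
  assumes L: "log_branch \<Psi> L" and z: "z \<notin> cut_ray \<Psi>" "z' \<notin> cut_ray \<Psi>"
  shows "exp ` closed_segment (L z) (L z') \<inter> cut_ray \<Psi> = {}" "\<bar>Im (L z) - Im (L z')\<bar> \<le> 2 * pi"
proof -
  obtain \<theta> where \<theta>: "cis \<theta> = - cis \<Psi>"
    "\<And>z. z \<notin> cut_ray \<Psi> \<Longrightarrow> \<theta> - pi < Im (L z) \<and> Im (L z) < \<theta> + pi"
    using log_branch_Im_bounds[OF L] by blast
  have "convex {u. \<theta> - pi < Im u \<and> Im u < \<theta> + pi}"
    by (auto simp: Collect_conj_eq intro!: convex_Int convex_halfspace_Im_gt convex_halfspace_Im_lt)
  hence "closed_segment (L z) (L z') \<subseteq> {u. \<theta> - pi < Im u \<and> Im u < \<theta> + pi}"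
    using z \<theta>(2) by (intro closed_segment_subset) auto
  thus "exp ` closed_segment (L z) (L z') \<inter> cut_ray \<Psi> = {}"
    using exp_notin_cut_ray[OF \<theta>(1)] by blast
  show "\<bar>Im (L z) - Im (L z')\<bar> \<le> 2 * pi"
    using \<theta>(2)[OF z(1)] \<theta>(2)[OF z(2)] by linarith
qed

lemma norm_exp_closed_segment_ge:
  fixes u v :: complex
  assumes "z \<in> exp ` closed_segment u v" "R \<le> norm (exp u)" "R \<le> norm (exp v)"
  shows "R \<le> norm z"
proof -
  obtain p where p: "z = exp p" "p \<in> closed_segment u v" using assms(1) by blast
  have "closed_segment u v \<subseteq> {p. min (Re u) (Re v) \<le> Re p}"
    by (intro closed_segment_subset) (auto simp: convex_halfspace_Re_ge)
  hence "min (Re u) (Re v) \<le> Re p" using p(2) by blast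
  hence "exp (min (Re u) (Re v)) \<le> norm z" by (simp add: p(1))
  thus ?thesis using assms(2,3) by (auto simp: min_def split: if_splits)
qed

section \<open>Integrals over the whole contour\<close>

text \<open>
  Think of \<open>\<rho>\<close> as the distance of a curve from the origin and of \<open>D\<close> as its speed.  The mass of \<open>D\<close> where
  \<open>\<rho> \<le> 2 ^ m\<close> is at most \<open>C * 2 ^ m\<close>, and the weight there, up to the parts where \<open>\<rho>\<close> is smaller, is
  \<open>2 powr (- \<beta> * m)\<close>; since \<open>\<beta> > 1\<close> the products form a convergent geometric series.  The result is
  stated as the existence of an integrable majorant, as that is what domination arguments consume.
\<close>
lemma integrable_powr_of_linear_growth:
  fixes \<rho> D :: "real \<Rightarrow> real"
  assumes D: "\<And>t. 0 \<le> D t" and \<rho>: "\<And>t. r \<le> \<rho> t" "0 < r" and \<beta>: "1 < \<beta>"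
    and growth: "\<And>R. 1 \<le> R \<Longrightarrow> D integrable_on {t. \<rho> t \<le> R} \<and> integral {t. \<rho> t \<le> R} D \<le> C * R"
  obtains g where "g integrable_on UNIV" "\<And>t. \<rho> t powr (- \<beta>) * D t \<le> g t"
proof -
  \<comment> \<open>\<open>g\<close> collects the dyadic shells: on the shell where \<open>\<rho> t\<close> is about \<open>2 ^ m\<close> the weight is about \<open>q ^ m\<close>;
    the first argument of \<open>max\<close> in \<open>K\<close> covers the part where \<open>\<rho> t \<le> 1\<close>\<close>
  define q where "q = (2::real) powr (- \<beta>)"
  define K where "K = max (r powr (- \<beta>)) (2 powr \<beta>)"
  define \<phi> where "\<phi> m t = (if \<rho> t \<le> 2 ^ m then D t else 0)" for m t
  define f where "f N t = (\<Sum>m<N. K * q ^ m * \<phi> m t)" for N t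
  define g where "g t = (\<Sum>m. K * q ^ m * \<phi> m t)" for t
  have q: "0 < q" "q < 1" "2 * q < 1"
  proof -
    show "0 < q" by (simp add: q_def)
    have "q < 2 powr (- 1)" unfolding q_def using \<beta> by (intro powr_less_mono) auto
    thus "q < 1" "2 * q < 1" by (simp_all add: powr_minus)
  qed
  have K: "0 < K" by (simp add: K_def less_max_iff_disj)
  have \<phi>0: "0 \<le> \<phi> m t" "\<phi> m t \<le> D t" for m t using D by (auto simp: \<phi>_def)
  have \<phi>_int: "(\<phi> m has_integral integral {t. \<rho> t \<le> 2 ^ m} D) UNIV" for m
  proof -
    have "(D has_integral integral {t. \<rho> t \<le> 2 ^ m} D) {t. \<rho> t \<le> 2 ^ m}"
      using growth[of "2 ^ m"] by (intro integrable_integral) simp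
    hence "((\<lambda>t. if t \<in> {t. \<rho> t \<le> 2 ^ m} then D t else 0) has_integral integral {t. \<rho> t \<le> 2 ^ m} D) UNIV"
      by (simp only: has_integral_restrict_UNIV)
    thus ?thesis by (simp add: \<phi>_def[abs_def])
  qed
  have f_int: "(f N has_integral (\<Sum>m<N. K * q ^ m * integral {t. \<rho> t \<le> 2 ^ m} D)) UNIV" for N
    unfolding f_def by (intro has_integral_sum has_integral_mult_right \<phi>_int) auto
  have summ: "summable (\<lambda>m. K * q ^ m * \<phi> m t)" for t
  proof (rule summable_comparison_test')
    show "summable (\<lambda>m. K * D t * q ^ m)" using q by (intro summable_mult summable_geometric) auto
    show "norm (K * q ^ m * \<phi> m t) \<le> K * D t * q ^ m" for m
      using \<phi>0[of m t] K q by (simp add: abs_mult mult_left_mono mult_right_mono)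
  qed
  have "g integrable_on UNIV \<and> (\<lambda>N. integral UNIV (f N)) \<longlonglongrightarrow> integral UNIV g"
  proof (rule monotone_convergence_increasing)
    show "f N integrable_on UNIV" for N using f_int by blast
    show "f N t \<le> f (Suc N) t" for N t using K q \<phi>0 by (simp add: f_def)
    show "(\<lambda>N. f N t) \<longlonglongrightarrow> g t" for t
      unfolding f_def g_def using summ by (rule summable_LIMSEQ)
    have "norm (integral UNIV (f N)) \<le> K * \<bar>C\<bar> * (1 / (1 - 2 * q))" for N
    proof -
      have "0 \<le> integral UNIV (f N)"
        using f_int K q \<phi>0 by (intro integral_nonneg) (auto simp: f_def intro!: sum_nonneg)
      moreover have "integral UNIV (f N) = (\<Sum>m<N. K * q ^ m * integral {t. \<rho> t \<le> 2 ^ m} D)"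
        using f_int by (rule integral_unique)
      moreover have "\<dots> \<le> (\<Sum>m<N. K * q ^ m * (\<bar>C\<bar> * 2 ^ m))"
      proof (intro sum_mono mult_left_mono)
        fix m
        have "integral {t. \<rho> t \<le> 2 ^ m} D \<le> C * 2 ^ m" using growth[of "2 ^ m"] by simp
        also have "\<dots> \<le> \<bar>C\<bar> * 2 ^ m" by (intro mult_right_mono) auto
        finally show "integral {t. \<rho> t \<le> 2 ^ m} D \<le> \<bar>C\<bar> * 2 ^ m" .
      qed (use K q in auto)
      moreover have "\<dots> = K * \<bar>C\<bar> * (\<Sum>m<N. (2 * q) ^ m)"
        by (simp add: sum_distrib_left power_mult_distrib mult_ac)
      moreover have "(\<Sum>m<N. (2 * q) ^ m) \<le> (\<Sum>m. (2 * q) ^ m)"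
        using q by (intro sum_le_suminf summable_geometric) auto
      moreover have "(\<Sum>m. (2 * q) ^ m) = 1 / (1 - 2 * q)" using q by (intro suminf_geometric) auto
      ultimately show ?thesis using K by (smt (verit) mult_left_mono real_norm_def mult_nonneg_nonneg)
    qed
    thus "bounded (range (\<lambda>N. integral UNIV (f N)))" by (auto simp: bounded_iff)
  qed
  moreover have "\<rho> t powr (- \<beta>) * D t \<le> g t" for t
  proof -
    have ex: "\<exists>m. \<rho> t \<le> 2 ^ m" using real_arch_pow[of 2 "\<rho> t"] by (auto intro: less_imp_le)
    define m where "m = (LEAST m. \<rho> t \<le> 2 ^ m)"
    have m: "\<rho> t \<le> 2 ^ m" unfolding m_def using ex by (rule LeastI_ex)
    have "\<rho> t powr (- \<beta>) \<le> K * q ^ m"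
    proof (cases m)
      case 0
      have "\<rho> t powr (- \<beta>) \<le> r powr (- \<beta>)" using \<rho> \<beta> by (intro powr_mono2') auto
      thus ?thesis using 0 by (simp add: K_def)
    next
      case (Suc j)
      hence "2 ^ j < \<rho> t" using not_less_Least[of j "\<lambda>m. \<rho> t \<le> 2 ^ m"] m_def by simp
      hence "\<rho> t powr (- \<beta>) \<le> (2 ^ j) powr (- \<beta>)" using \<beta> by (intro powr_mono2') auto
      also have "(2 ^ j) powr (- \<beta>) = q ^ j"
        unfolding q_def by (simp add: powr_power flip: powr_realpow) (simp add: powr_powr mult.commute)
      also have "\<dots> = 2 powr \<beta> * q ^ m" using q by (simp add: Suc q_def flip: powr_add)
      also have "\<dots> \<le> K * q ^ m" using q by (intro mult_right_mono) (auto simp: K_def)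
      finally show ?thesis .
    qed
    hence "\<rho> t powr (- \<beta>) * D t \<le> K * q ^ m * \<phi> m t"
      using D m by (simp add: \<phi>_def mult_right_mono)
    also have "\<dots> = (\<Sum>m\<in>{m}. K * q ^ m * \<phi> m t)" by simp
    also have "\<dots> \<le> g t" unfolding g_def using K q \<phi>0 by (intro sum_le_suminf summ) auto
    finally show ?thesis .
  qed
  ultimately show thesis using that by blast
qed

lemma unbounded_contour_continuous:
  assumes "unbounded_contour \<gamma>"
  shows "continuous_on UNIV \<gamma>"
  unfolding continuous_on_eq_continuous_at[OF open_UNIV]
proof
  fix t :: real
  have "continuous_on {t - 1..t + 1} \<gamma>"
    using assms unfolding unbounded_contour_def piecewise_C1_differentiable_on_def by blast
  thus "isCont \<gamma> t"
    by (rule continuous_on_interior) simp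
qed

lemma unbounded_contour_ends:
  assumes "unbounded_contour \<gamma>"
  shows "filterlim (\<lambda>T. norm (\<gamma> T)) at_top at_top" "filterlim (\<lambda>T. norm (\<gamma> (- T))) at_top at_top"
proof -
  have lim: "filterlim \<gamma> at_infinity at_top" "filterlim \<gamma> at_infinity at_bot"
    using assms by (auto simp: unbounded_contour_def)
  show "filterlim (\<lambda>T. norm (\<gamma> T)) at_top at_top"
    by (rule filterlim_at_infinity_imp_norm_at_top[OF lim(1)])
  show "filterlim (\<lambda>T. norm (\<gamma> (- T))) at_top at_top"
    by (rule filterlim_compose[OF filterlim_at_infinity_imp_norm_at_top[OF lim(2)]
          filterlim_uminus_at_bot_at_top])
qed

text \<open>
  A curve that tends to infinity at both ends and misses the origin keeps a positive distance from it,
  so the singularity of the power at 0 does no harm and only the growth of the length matters.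
\<close>
lemma unbounded_contour_integrable_powr:
  assumes \<gamma>: "unbounded_contour \<gamma>" and nz: "0 \<notin> range \<gamma>" and \<beta>: "1 < \<beta>"
  obtains g where "g integrable_on UNIV"
    "\<And>t. norm (\<gamma> t) powr (- \<beta>) * norm (vector_derivative \<gamma> (at t)) \<le> g t"
proof -
  have "\<forall>\<^sub>F T in at_top. 1 \<le> norm (\<gamma> T) \<and> 1 \<le> norm (\<gamma> (- T))"
    using unbounded_contour_ends[OF \<gamma>] by (simp add: filterlim_at_top eventually_conj_iff)
  then obtain T where T: "\<And>t. T \<le> t \<Longrightarrow> 1 \<le> norm (\<gamma> t) \<and> 1 \<le> norm (\<gamma> (- t))"
    unfolding eventually_at_top_linorder by blast
  have cont: "continuous_on {- \<bar>T\<bar>..\<bar>T\<bar>} (\<lambda>t. norm (\<gamma> t))"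
    by (intro continuous_on_norm continuous_on_subset[OF unbounded_contour_continuous[OF \<gamma>]]) simp
  have "\<exists>x\<in>{- \<bar>T\<bar>..\<bar>T\<bar>}. \<forall>t\<in>{- \<bar>T\<bar>..\<bar>T\<bar>}. norm (\<gamma> x) \<le> norm (\<gamma> t)"
    by (rule continuous_attains_inf[OF _ _ cont]) auto
  then obtain x where x: "\<And>t. t \<in> {- \<bar>T\<bar>..\<bar>T\<bar>} \<Longrightarrow> norm (\<gamma> x) \<le> norm (\<gamma> t)"
    by blast
  define r where "r = min 1 (norm (\<gamma> x))"
  have "\<gamma> x \<noteq> 0" using nz by (metis rangeI)
  hence r: "0 < r" by (simp add: r_def)
  have low: "r \<le> norm (\<gamma> t)" for t
  proof (cases "t \<in> {- \<bar>T\<bar>..\<bar>T\<bar>}")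
    case True
    thus ?thesis using x[of t] by (simp add: r_def)
  next
    case False
    hence "T \<le> t \<or> T \<le> - t" by auto
    hence "1 \<le> norm (\<gamma> t)" using T[of t] T[of "- t"] by auto
    thus ?thesis by (simp add: r_def)
  qed
  obtain C where C: "\<And>R. 1 \<le> R \<Longrightarrow>
      (\<lambda>t. norm (vector_derivative \<gamma> (at t))) integrable_on {t. norm (\<gamma> t) \<le> R} \<and>
      integral {t. norm (\<gamma> t) \<le> R} (\<lambda>t. norm (vector_derivative \<gamma> (at t))) \<le> C * R"
    using \<gamma> unfolding unbounded_contour_def by blast
  show thesis
    by (rule integrable_powr_of_linear_growth[OF norm_ge_zero low r \<beta> C]) (use that in blast)+
qed

lemma valid_path_subpath_unbounded_contour:
  assumes \<gamma>: "unbounded_contour \<gamma>" and uv: "u < v"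
  shows "valid_path (subpath u v \<gamma>)"
proof -
  have "(\<gamma> \<circ> (\<lambda>x. (v - u) * x + u)) piecewise_C1_differentiable_on {0..1}"
  proof (rule piecewise_C1_differentiable_compose)
    show "(\<lambda>x. (v - u) * x + u) piecewise_C1_differentiable_on {0..1}"
      by (simp add: C1_differentiable_imp_piecewise)
    show "\<gamma> piecewise_C1_differentiable_on (\<lambda>x. (v - u) * x + u) ` {0..1}"
      using \<gamma> uv by (simp add: image_affinity_atLeastAtMost unbounded_contour_def)
    show "\<And>x. finite ({0..1} \<inter> (\<lambda>x. (v - u) * x + u) -` {x})"
      using uv by (simp add: Int_commute[of "{0..1}"] inj_on_def finite_vimage_IntI)
  qed
  thus ?thesis by (auto simp: o_def valid_path_def subpath_def)
qed

lemma path_image_subpath_subset_range: "path_image (subpath u v \<gamma>) \<subseteq> range \<gamma>"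
  by (auto simp: path_image_def subpath_def)

text \<open>
  The substitution that translates between contour integrals, whose paths are parametrised by the unit
  interval, and integrals over a piece of a curve on the real line.
\<close>
lemma has_contour_integral_subpath_iff:
  fixes \<gamma> :: "real \<Rightarrow> complex"
  assumes \<gamma>: "\<gamma> piecewise_C1_differentiable_on {u..v}" and uv: "u < v"
  shows "(f has_contour_integral I) (subpath u v \<gamma>) \<longleftrightarrow>
           ((\<lambda>t. f (\<gamma> t) * vector_derivative \<gamma> (at t)) has_integral I) {u..v}"
proof -
  define F where "F t = f (\<gamma> t) * vector_derivative \<gamma> (at t)" for t
  obtain S where S: "finite S" "\<And>t. t \<in> {u..v} - S \<Longrightarrow> \<gamma> differentiable at t"
    using \<gamma> unfolding piecewise_C1_differentiable_on_def C1_differentiable_on_eq by blast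
  define S' where "S' = (\<lambda>x. (v - u) * x + u) -` S"
  have S': "finite S'" unfolding S'_def using uv S(1) by (intro finite_vimageI) (auto simp: inj_on_def)
  have vd: "vector_derivative (subpath u v \<gamma>) (at x) = (v - u) *\<^sub>R vector_derivative \<gamma> (at ((v - u) * x + u))"
    if "x \<in> {0..1} - S'" for x
    unfolding subpath_def
  proof (rule vector_derivative_at [OF vector_diff_chain_at [simplified o_def]])
    show "((\<lambda>x. (v - u) * x + u) has_vector_derivative v - u) (at x)"
      by (intro derivative_eq_intros | simp)+
    have "(v - u) * x \<le> v - u" using that uv by (intro mult_left_le) auto
    hence "(v - u) * x + u \<le> v" by linarith
    moreover have "u \<le> (v - u) * x + u" using that uv by simp
    ultimately have "(v - u) * x + u \<in> {u..v} - S" using that by (simp add: S'_def)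
    thus "(\<gamma> has_vector_derivative vector_derivative \<gamma> (at ((v - u) * x + u))) (at ((v - u) * x + u))"
      using S(2) by (simp add: vector_derivative_works)
  qed
  have "(f has_contour_integral I) (subpath u v \<gamma>) \<longleftrightarrow>
      ((\<lambda>x. (v - u) *\<^sub>R F ((v - u) *\<^sub>R x + u)) has_integral I) {0..1}"
    unfolding has_contour_integral
    by (rule has_integral_spike_finite_eq[OF S']) (use vd in \<open>auto simp: subpath_def F_def\<close>)
  also have "\<dots> \<longleftrightarrow> ((\<lambda>x. F ((v - u) *\<^sub>R x + u)) has_integral (I /\<^sub>R (v - u))) {0..1}"
    using uv has_integral_cmul[of _ "I /\<^sub>R (v - u)" "{0..1}" "v - u"]
      has_integral_cmul[of "\<lambda>x. (v - u) *\<^sub>R F ((v - u) *\<^sub>R x + u)" I "{0..1}" "inverse (v - u)"]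
    by fastforce
  also have "\<dots> \<longleftrightarrow> (F has_integral I) {u..v}"
    using has_integral_affinity_iff[of "v - u" F u I u v] uv by simp
  finally show ?thesis by (simp add: F_def[abs_def])
qed

lemma integrable_unbounded_contour_holomorphic:
  assumes \<gamma>: "unbounded_contour \<gamma>" and f: "f holomorphic_on S" "open S" "range \<gamma> \<subseteq> S"
  shows "(\<lambda>t. f (\<gamma> t) * vector_derivative \<gamma> (at t)) integrable_on {u..v}"
proof (cases "u < v")
  case True
  have "f contour_integrable_on (subpath u v \<gamma>)"
    by (rule contour_integrable_holomorphic_simple[OF f(1,2) valid_path_subpath_unbounded_contour[OF \<gamma> True]
          subset_trans[OF path_image_subpath_subset_range f(3)]])
  moreover have "\<gamma> piecewise_C1_differentiable_on {u..v}"
    using \<gamma> by (simp add: unbounded_contour_def)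
  ultimately show ?thesis
    unfolding contour_integrable_on_def integrable_on_def
    using has_contour_integral_subpath_iff[OF _ True] by blast
next
  case False
  thus ?thesis by (intro integrable_on_null[of u v, unfolded box_real]) simp
qed

lemma has_integral_improper_dominated:
  fixes f :: "real \<Rightarrow> complex"
  assumes int: "\<And>u v. f integrable_on {u..v}" and le: "\<And>t. norm (f t) \<le> g t" and g: "g integrable_on UNIV"
    and lim: "((\<lambda>T. integral {- T..T} f) \<longlongrightarrow> I) at_top"
  shows "(f has_integral I) UNIV"
proof -
  have f: "f integrable_on UNIV"
    by (rule integrable_on_all_intervals_UNIV[OF _ le g]) (simp add: int)
  define h where "h n t = (if t \<in> {- real n..real n} then f t else 0)" for n t
  have "(\<lambda>n. integral UNIV (h n)) \<longlonglongrightarrow> integral UNIV f"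
  proof (rule dominated_convergence(2)[OF _ g])
    show "h n integrable_on UNIV" for n
      unfolding h_def[abs_def] integrable_restrict_UNIV by (rule int)
    show "norm (h n t) \<le> g t" for n t
    proof -
      have "0 \<le> g t" using le[of t] norm_ge_zero[of "f t"] by linarith
      thus ?thesis using le[of t] by (simp add: h_def)
    qed
    show "(\<lambda>n. h n t) \<longlonglongrightarrow> f t" for t
    proof (rule tendsto_eventually)
      show "\<forall>\<^sub>F n in sequentially. h n t = f t"
        using eventually_ge_at_top[of "nat \<lceil>\<bar>t\<bar>\<rceil>"]
      proof eventually_elim
        case (elim n)
        hence "- real n \<le> t \<and> t \<le> real n" by linarith
        thus ?case by (simp add: h_def)
      qed
    qed
  qed
  moreover have "integral UNIV (h n) = integral {- real n..real n} f" for n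
    unfolding h_def[abs_def] by (rule integral_restrict_UNIV)
  moreover have "(\<lambda>n. integral {- real n..real n} f) \<longlonglongrightarrow> I"
    by (rule filterlim_compose[OF lim filterlim_real_sequentially])
  ultimately have "integral UNIV f = I"
    by (intro LIMSEQ_unique[of "\<lambda>n. integral UNIV (h n)"]) simp_all
  thus ?thesis using f by (auto simp: has_integral_iff)
qed

section \<open>Cauchy's formula for unbounded contours\<close>

text \<open>
  In the logarithmic coordinate the integrand has size \<open>exp (- \<epsilon> * Re p)\<close>.  Moving in the real
  direction, its integral is given by the fundamental theorem of calculus and is bounded by the values
  at the endpoints however long the segment is; a bound by length times maximum would fail when one
  endpoint is far larger in modulus than the other.  Moving in the imaginary direction, the length is
  at most \<open>B\<close>.
\<close>
lemma log_segment_integral_le: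
  assumes bound: "\<And>z. z \<in> exp ` closed_segment u v \<Longrightarrow> norm (f z) \<le> K * norm z powr (- 1 - \<epsilon>)"
    and int: "f contour_integrable_on (exp \<circ> linepath u v)"
    and \<epsilon>: "0 < \<epsilon>" and K: "0 \<le> K" and Im: "\<bar>Im u - Im v\<bar> \<le> B"
  shows "norm (contour_integral (exp \<circ> linepath u v) f)
           \<le> K * (1 / \<epsilon> + B) * (norm (exp u) powr (- \<epsilon>) + norm (exp v) powr (- \<epsilon>))"
proof -
  define x y d where "x = Re u" and "y = Re v" and "d = y - x"
  define p where "p t = x + t * d" for t
  define E where "E = exp (- \<epsilon> * x) + exp (- \<epsilon> * y)"
  have Rep: "Re (linepath u v t) = p t" for t
    by (simp add: linepath_def p_def x_def y_def d_def algebra_simps)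
  have vd: "vector_derivative (exp \<circ> linepath u v) (at t) = (v - u) * exp (linepath u v t)" for t
    using vector_derivative_at[OF field_vector_diff_chain_at[OF has_vector_derivative_linepath_within[of u v t UNIV] DERIV_exp]]
    by simp
  \<comment> \<open>the factor \<open>d\<close> is part of the integrand, so that horizontal and vertical segments need no
    separate treatment; \<open>sgn d\<close> turns it into its absolute value afterwards\<close>
  have ftc: "((\<lambda>t. exp (- \<epsilon> * p t) * d) has_integral
      (- exp (- \<epsilon> * p 1) / \<epsilon> - (- exp (- \<epsilon> * p 0) / \<epsilon>))) {0..1}"
    by (rule fundamental_theorem_of_calculus)
       (use \<epsilon> in \<open>auto simp: p_def has_real_derivative_iff_has_vector_derivative[symmetric]
          intro!: derivative_eq_intros\<close>)
  define h where "h t = K * (sgn d * (exp (- \<epsilon> * p t) * d) + B * E)" for t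
  define J where "J = K * (sgn d * (- exp (- \<epsilon> * p 1) / \<epsilon> - (- exp (- \<epsilon> * p 0) / \<epsilon>)) + B * E)"
  have h: "(h has_integral J) {0..1}"
  proof -
    have "((\<lambda>t. B * E) has_integral (B * E)) {0..1::real}"
      using has_integral_const_real[of "B * E" 0 1] by simp
    thus ?thesis unfolding h_def J_def by (intro has_integral_mult_right[OF has_integral_add[OF has_integral_mult_right[OF ftc]]])
  qed
  have "norm (contour_integral (exp \<circ> linepath u v) f) \<le> J"
  proof -
    define F where "F t = f ((exp \<circ> linepath u v) t) * vector_derivative (exp \<circ> linepath u v) (at t)" for t
    have "norm (integral {0..1} F) \<le> integral {0..1} h"
    proof (rule integral_norm_bound_integral)
      show "F integrable_on {0..1}" using int unfolding F_def contour_integrable_on .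
      show "h integrable_on {0..1}" using h by blast
      fix t :: real assume t: "t \<in> {0..1}"
      let ?z = "exp (linepath u v t)"
      have "?z \<in> exp ` closed_segment u v" using t by (auto simp: linepath_in_path)
      moreover have nz: "norm ?z = exp (p t)" by (simp add: Rep)
      ultimately have "norm (f ?z) \<le> K * exp ((- 1 - \<epsilon>) * p t)"
        using bound[of ?z] by (simp add: powr_def)
      hence "norm (F t) \<le> K * exp ((- 1 - \<epsilon>) * p t) * (norm (v - u) * exp (p t))"
        unfolding F_def by (simp add: vd norm_mult Rep mult_right_mono)
      also have "\<dots> = K * (exp (- \<epsilon> * p t) * norm (v - u))"
        by (simp add: algebra_simps flip: exp_add)
      also have "\<dots> \<le> K * (exp (- \<epsilon> * p t) * (\<bar>d\<bar> + B))"
      proof -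
        have "norm (v - u) \<le> \<bar>d\<bar> + B"
          using cmod_le[of "v - u"] Im by (simp add: d_def x_def y_def)
        thus ?thesis using K by (intro mult_left_mono) auto
      qed
      also have "\<dots> = K * (sgn d * (exp (- \<epsilon> * p t) * d) + B * exp (- \<epsilon> * p t))"
        by (simp add: algebra_simps abs_sgn)
      also have "\<dots> \<le> h t"
      proof -
        have "min x y \<le> p t"
        proof -
          have "p t = (1 - t) * x + t * y" by (simp add: p_def d_def algebra_simps)
          moreover have "(1 - t) * min x y \<le> (1 - t) * x" "t * min x y \<le> t * y"
            using t by (auto intro!: mult_left_mono)
          moreover have "(1 - t) * min x y + t * min x y = min x y" by (simp add: algebra_simps)
          ultimately show ?thesis by linarith
        qed
        hence "exp (- \<epsilon> * p t) \<le> exp (- \<epsilon> * min x y)" using \<epsilon> by simp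
        also have "\<dots> \<le> E" by (simp add: E_def min_def)
        finally show ?thesis unfolding h_def using K Im
          by (intro mult_left_mono add_left_mono) auto
      qed
      finally show "norm (F t) \<le> h t" .
    qed
    thus ?thesis unfolding contour_integral_integral F_def using h by (simp add: integral_unique)
  qed
  also have "J \<le> K * (1 / \<epsilon> * E + B * E)"
  proof -
    have "sgn d * (- exp (- \<epsilon> * p 1) / \<epsilon> - (- exp (- \<epsilon> * p 0) / \<epsilon>)) \<le> E / \<epsilon>"
    proof -
      have "sgn d * (exp (- \<epsilon> * x) - exp (- \<epsilon> * y)) \<le> E"
        by (auto simp: E_def sgn_if intro: order_trans[OF _ less_imp_le[OF exp_gt_zero]])
      hence "sgn d * (exp (- \<epsilon> * x) - exp (- \<epsilon> * y)) / \<epsilon> \<le> E / \<epsilon>"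
        using \<epsilon> by (intro divide_right_mono) auto
      moreover have "p 0 = x" "p 1 = y" by (auto simp: p_def d_def)
      ultimately show ?thesis by (simp add: algebra_simps diff_divide_distrib)
    qed
    thus ?thesis unfolding J_def using K by (intro mult_left_mono) auto
  qed
  also have "\<dots> = K * (1 / \<epsilon> + B) * (norm (exp u) powr (- \<epsilon>) + norm (exp v) powr (- \<epsilon>))"
    by (simp add: E_def x_def y_def powr_def algebra_simps)
  finally show ?thesis .
qed

text \<open>
  Closing up the truncated contour gives a loop in the cut plane that winds once round \<open>w\<close> and not at
  all round points of the cut, so the global form of Cauchy's formula applies to it.  The decay
  hypothesis is needed on the contour, where it gives absolute integrability, and near infinity, where
  it makes the closing arcs negligible.
\<close>
proposition Cauchy_integral_formula_unbounded_contour: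
  assumes L: "log_branch \<Psi> L" and \<gamma>: "unbounded_contour \<gamma>" and cut: "range \<gamma> \<inter> cut_ray \<Psi> = {}"
    and g: "g holomorphic_on (- cut_ray \<Psi>)"
    and w: "w \<notin> cut_ray \<Psi>" "w \<notin> range \<gamma>" "encloses_ccw L \<gamma> w"
    and \<epsilon>: "0 < \<epsilon>" and K: "0 \<le> K"
    and bound: "\<And>z. z \<notin> cut_ray \<Psi> \<Longrightarrow> z \<in> range \<gamma> \<or> R \<le> norm z \<Longrightarrow>
                  norm (g z / (z - w)) \<le> K * norm z powr (- 1 - \<epsilon>)"
  shows "((\<lambda>t. g (\<gamma> t) / (\<gamma> t - w) * vector_derivative \<gamma> (at t)) has_integral (2 * pi * \<i> * g w)) UNIV"
proof -
  define f where "f z = g z / (z - w)" for z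
  define S where "S = - cut_ray \<Psi>"
  have S: "open S" "open (S - {w})" "range \<gamma> \<subseteq> S - {w}"
    using closed_cut_ray[of \<Psi>] cut w by (auto simp: S_def)
  have f: "f holomorphic_on (S - {w})"
    unfolding f_def S_def by (intro holomorphic_intros holomorphic_on_subset[OF g]) auto
  have off: "\<gamma> t \<notin> cut_ray \<Psi>" for t using cut by blast
  have eL: "exp (L (\<gamma> t)) = \<gamma> t" for t using L off by (simp add: log_branch_def)
  have nz: "0 \<notin> range \<gamma>" using cut zero_in_cut_ray by blast
  obtain G where G: "G integrable_on UNIV"
    "\<And>t. norm (\<gamma> t) powr (- (1 + \<epsilon>)) * norm (vector_derivative \<gamma> (at t)) \<le> G t"
    using unbounded_contour_integrable_powr[OF \<gamma> nz, of "1 + \<epsilon>"] \<epsilon> by auto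
  define F where "F t = f (\<gamma> t) * vector_derivative \<gamma> (at t)" for t
  define arc where "arc T = exp \<circ> linepath (L (\<gamma> T)) (L (\<gamma> (- T)))" for T
  define E where "E T = K * (1 / \<epsilon> + 2 * pi) * (norm (\<gamma> T) powr (- \<epsilon>) + norm (\<gamma> (- T)) powr (- \<epsilon>))" for T

  \<comment> \<open>\<open>E T\<close> bounds the contribution of the closing arc, which is all that separates the truncated
    integral from Cauchy's formula for the closed curve\<close>
  have closing: "norm (integral {- T..T} F - 2 * pi * \<i> * g w) \<le> E T"
    if T: "0 < T" "R \<le> norm (\<gamma> T)" "R \<le> norm (\<gamma> (- T))"
      and enc: "w \<notin> path_image (closed_up L \<gamma> T)" "winding_number (closed_up L \<gamma> T) w = 1" for T
  proof -
    let ?p = "subpath (- T) T \<gamma>"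
    have cu: "closed_up L \<gamma> T = ?p +++ arc T" by (simp add: closed_up_def arc_def)
    have vp: "valid_path ?p" using T by (intro valid_path_subpath_unbounded_contour \<gamma>) auto
    have va: "valid_path (arc T)"
      unfolding arc_def by (rule valid_path_compose_holomorphic[of _ exp UNIV]) (auto intro!: holomorphic_intros)
    have ends: "pathfinish ?p = pathstart (arc T)" "pathfinish (arc T) = pathstart ?p"
      by (simp_all add: arc_def pathstart_def pathfinish_def subpath_def linepath_def eL)
    have img: "path_image (arc T) = exp ` closed_segment (L (\<gamma> T)) (L (\<gamma> (- T)))"
      by (simp add: arc_def path_image_compose)
    have img_cu: "path_image (closed_up L \<gamma> T) = path_image ?p \<union> path_image (arc T)"
      unfolding cu using ends by (intro path_image_join)
    have sub: "path_image (closed_up L \<gamma> T) \<subseteq> S - {w}"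
      using closing_arc_avoids_cut(1)[OF L off off, of T "- T"] enc(1)
        path_image_subpath_subset_range[of "- T" T \<gamma>] S(3)
      unfolding img_cu img S_def by blast
    have "(f has_contour_integral 2 * pi * \<i> * winding_number (closed_up L \<gamma> T) w * g w) (closed_up L \<gamma> T)"
      unfolding f_def[abs_def]
    proof (rule Cauchy_integral_formula_global)
      show "open S" "g holomorphic_on S" "w \<in> S" using S g w by (auto simp: S_def)
      show "path_image (closed_up L \<gamma> T) \<subseteq> S - {w}" by (rule sub)
      show "valid_path (closed_up L \<gamma> T)" unfolding cu using vp va ends by (intro valid_path_join)
      show "pathfinish (closed_up L \<gamma> T) = pathstart (closed_up L \<gamma> T)" unfolding cu using ends by simp
      show "winding_number (closed_up L \<gamma> T) z = 0" if "z \<notin> S" for z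
        using that winding_number_cut_ray[OF L unbounded_contour_continuous[OF \<gamma>] cut] by (simp add: S_def)
    qed
    hence total: "(f has_contour_integral 2 * pi * \<i> * g w) (?p +++ arc T)"
      using enc(2) by (simp add: cu)
    have ip: "f contour_integrable_on ?p" and ia: "f contour_integrable_on (arc T)"
      using total vp va by (auto simp: contour_integrable_on_def dest!: has_contour_integral_integrable
          intro: contour_integrable_joinD1[unfolded contour_integrable_on_def]
                 contour_integrable_joinD2[unfolded contour_integrable_on_def])
    have "contour_integral ?p f + contour_integral (arc T) f = 2 * pi * \<i> * g w"
      using contour_integral_unique[OF total] contour_integral_join[OF ip ia vp va] by simp
    moreover have "integral {- T..T} F = contour_integral ?p f"
    proof (rule integral_unique)
      have "\<gamma> piecewise_C1_differentiable_on {- T..T}" using \<gamma> by (simp add: unbounded_contour_def)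
      thus "(F has_integral contour_integral ?p f) {- T..T}"
        using has_contour_integral_subpath_iff[of \<gamma> "- T" T f] T(1) has_contour_integral_integral[OF ip]
        unfolding F_def[abs_def] by simp
    qed
    moreover have "norm (contour_integral (arc T) f) \<le> E T"
    proof -
      have "norm (contour_integral (arc T) f) \<le> K * (1 / \<epsilon> + 2 * pi) *
          (norm (exp (L (\<gamma> T))) powr (- \<epsilon>) + norm (exp (L (\<gamma> (- T)))) powr (- \<epsilon>))"
        unfolding arc_def
      proof (rule log_segment_integral_le[OF _ _ \<epsilon> K])
        fix z assume z: "z \<in> exp ` closed_segment (L (\<gamma> T)) (L (\<gamma> (- T)))"
        hence "z \<notin> cut_ray \<Psi>" using closing_arc_avoids_cut(1)[OF L off off, of T "- T"] by blast
        moreover have "R \<le> norm z" using norm_exp_closed_segment_ge[OF z] T by (simp add: eL)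
        ultimately show "norm (f z) \<le> K * norm z powr (- 1 - \<epsilon>)" unfolding f_def by (intro bound) auto
      qed (use ia closing_arc_avoids_cut(2)[OF L off off, of T "- T"] in \<open>auto simp: arc_def\<close>)
      thus ?thesis by (simp add: E_def eL)
    qed
    ultimately show ?thesis by (smt (verit) add_diff_cancel_left' norm_minus_commute)
  qed

  have "(F has_integral (2 * pi * \<i> * g w)) UNIV"
  proof (rule has_integral_improper_dominated)
    show "F integrable_on {u..v}" for u v
      unfolding F_def by (rule integrable_unbounded_contour_holomorphic[OF \<gamma> f S(2,3)])
    show "norm (F t) \<le> K * G t" for t
    proof -
      have "norm (F t) \<le> (K * norm (\<gamma> t) powr (- 1 - \<epsilon>)) * norm (vector_derivative \<gamma> (at t))"
        unfolding F_def f_def norm_mult using off by (intro mult_right_mono bound) auto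
      also have "\<dots> = K * (norm (\<gamma> t) powr (- (1 + \<epsilon>)) * norm (vector_derivative \<gamma> (at t)))" by simp
      also have "\<dots> \<le> K * G t" using G(2) K by (rule mult_left_mono)
      finally show ?thesis .
    qed
    show "(\<lambda>t. K * G t) integrable_on UNIV" using G(1) by (rule integrable_on_mult_right)
    have "(E \<longlongrightarrow> K * (1 / \<epsilon> + 2 * pi) * (0 + 0)) at_top"
      unfolding E_def using \<epsilon> by (intro tendsto_intros tendsto_neg_powr unbounded_contour_ends[OF \<gamma>]) auto
    hence E: "(E \<longlongrightarrow> 0) at_top" by simp
    have "\<forall>\<^sub>F T in at_top. norm (integral {- T..T} F - 2 * pi * \<i> * g w) \<le> E T"
    proof -
      have "\<forall>\<^sub>F T in at_top. R \<le> norm (\<gamma> T)" "\<forall>\<^sub>F T in at_top. R \<le> norm (\<gamma> (- T))"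
        using unbounded_contour_ends[OF \<gamma>] by (auto simp: filterlim_at_top)
      thus ?thesis
        using w(3)[unfolded encloses_ccw_def] eventually_gt_at_top[of 0]
        by eventually_elim (use closing in blast)
    qed
    hence "((\<lambda>T. integral {- T..T} F - 2 * pi * \<i> * g w) \<longlongrightarrow> 0) at_top"
      using E by (rule Lim_null_comparison)
    thus "((\<lambda>T. integral {- T..T} F) \<longlongrightarrow> 2 * pi * \<i> * g w) at_top"
      by (simp add: LIM_zero_iff)
  qed
  thus ?thesis by (simp add: F_def[abs_def] f_def)
qed

section \<open>The zeta function as a contour integral\<close>

theorem theorem2p4:
  fixes a :: "nat \<Rightarrow> complex" and \<alpha> \<Psi> \<delta> :: real and k :: nat
    and L H :: "complex \<Rightarrow> complex" and \<gamma> :: "real \<Rightarrow> complex" and s :: complex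
  assumes a_nonzero: "0 < norm (a 0)"
    and a_mono: "\<And>n. norm (a n) \<le> norm (a (Suc n))"
    and a_lim: "filterlim (\<lambda>n. norm (a n)) at_top sequentially"
    and exponent: "convergence_exponent a = ereal \<alpha>"
    and Psi: "- pi \<le> \<Psi>" "\<Psi> < pi"
    and a_arg: "\<And>n. arg_co (a n) \<noteq> \<Psi>"
    and branch: "log_branch \<Psi> L"
    and k: "k = nat \<lfloor>\<alpha>\<rfloor> + 1"
    and H: "H = canonical_product k a"
    and delta: "0 < \<delta>"
    and contour: "unbounded_contour \<gamma>"
    and off_discs: "range \<gamma> \<subseteq> - excluded_discs \<delta> a"
    and off_cut: "range \<gamma> \<inter> cut_ray \<Psi> = {}"
    and encloses: "\<And>n. encloses_ccw L \<gamma> (a n)"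
    and s: "Re s > \<alpha>"
  shows "\<exists>I. has_line_integral (\<lambda>z. branch_power L z (- s) * (deriv H z / H z)) I \<gamma> \<and>
             zeta_seq L a s = 1 / (2 * of_real pi * \<i>) * I"
proof -
  define m where "m = nat \<lfloor>\<alpha>\<rfloor>"
  have k': "k = Suc m" by (simp add: k m_def)
  have a0: "a n \<noteq> 0" for n
  proof -
    have "norm (a 0) \<le> norm (a n)" using a_mono by (rule lift_Suc_mono_le) simp
    thus ?thesis using a_nonzero by auto
  qed
  have \<alpha>: "0 \<le> \<alpha>" using convergence_exponent_nonneg[OF a_lim] by (simp add: exponent)
  have m: "real m \<le> \<alpha>" "\<alpha> < real m + 1" using \<alpha> unfolding m_def by linarith+
  \<comment> \<open>above \<open>\<alpha>\<close> for convergence of the sum over \<open>n\<close>, below \<open>Re s\<close> for convergence of the integral,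
    below \<open>m + 1\<close> for the estimate of the single terms\<close>
  obtain p where p: "\<alpha> < p" "p < min (Re s) (real m + 1)"
    using dense[of \<alpha> "min (Re s) (real m + 1)"] s m(2) by auto
  have summ: "summable (\<lambda>n. norm (a n) powr (- p))"
    by (rule summable_norm_powr_convergence_exponent[OF a_lim]) (simp add: exponent p)
  have summ_k: "summable (\<lambda>n. norm (a n) powr (- real (Suc m)))"
    by (rule summable_norm_powr_convergence_exponent[OF a_lim]) (use m in \<open>simp add: exponent\<close>)
  have off: "\<gamma> t \<notin> cut_ray \<Psi>" for t using off_cut by blast
  have nz: "0 \<notin> range \<gamma>" using off_cut zero_in_cut_ray by blast
  have disc: "\<delta> * norm (a n) < norm (z - a n)" if "z \<in> range \<gamma>" for n z
    using that off_discs by (force simp: excluded_discs_def norm_minus_commute not_le)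
  have a_off: "a n \<notin> cut_ray \<Psi>" "a n \<notin> range \<gamma>" for n
    using not_in_cut_ray[OF Psi a0 a_arg] disc[of "a n" n] delta a0[of n] by (auto simp: mult_less_0_iff)

  obtain B where B: "0 \<le> B" "\<And>z. z \<notin> cut_ray \<Psi> \<Longrightarrow> norm (branch_power L z (- s)) \<le> B * norm z powr (- Re s)"
    using norm_branch_power_le[OF branch, of s] by blast
  define \<epsilon> where "\<epsilon> = Re s - p"
  have \<epsilon>: "0 < \<epsilon>" using p by (simp add: \<epsilon>_def)
  define M where "M = B * (1 + 2 / \<delta>)"
  have M: "0 \<le> M" using B delta by (simp add: M_def)
  define g where "g n z = branch_power L z (- s) * (z / a n) ^ m" for n z

  \<comment> \<open>valid on the contour, which avoids the discs, and also at all large \<open>z\<close>, as the closing arcs require\<close>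
  have bound: "norm (g n z / (z - a n)) \<le> M * norm (a n) powr (- p) * norm z powr (- 1 - \<epsilon>)"
    if z: "z \<notin> cut_ray \<Psi>" "z \<in> range \<gamma> \<or> (1 + \<delta>) * norm (a n) \<le> norm z" for n z
  proof -
    have z0: "z \<noteq> 0" using z zero_in_cut_ray by auto
    have "\<delta> * norm (a n) \<le> norm (z - a n)"
      using z(2)
    proof
      assume "(1 + \<delta>) * norm (a n) \<le> norm z"
      thus ?thesis using norm_triangle_ineq2[of z "a n"] by (simp add: distrib_right)
    qed (use disc in \<open>auto intro: less_imp_le\<close>)
    hence "norm ((z / a n) ^ m / (z - a n)) \<le> (1 + 2 / \<delta>) * norm (a n) powr (- p) * norm z powr (p - 1)"
      using delta a0 z0 m p by (intro norm_term_le) auto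
    hence "norm (branch_power L z (- s)) * norm ((z / a n) ^ m / (z - a n)) \<le>
        (B * norm z powr (- Re s)) * ((1 + 2 / \<delta>) * norm (a n) powr (- p) * norm z powr (p - 1))"
      using B z(1) by (intro mult_mono) auto
    also have "\<dots> = M * norm (a n) powr (- p) * (norm z powr (- Re s) * norm z powr (p - 1))"
      by (simp add: M_def)
    also have "norm z powr (- Re s) * norm z powr (p - 1) = norm z powr (- 1 - \<epsilon>)"
      by (simp add: \<epsilon>_def algebra_simps flip: powr_add)
    finally show ?thesis by (simp add: g_def norm_mult norm_divide)
  qed

  have hol: "g n holomorphic_on (- cut_ray \<Psi>)" for n
    using branch unfolding g_def branch_power_def log_branch_def by (auto intro!: holomorphic_intros)
  \<comment> \<open>\<open>F\<close> and, below, \<open>D\<close> are the \<open>n\<close>-th term and the full integrand in the parameter of the curve\<close>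
  define F where "F n t = g n (\<gamma> t) / (\<gamma> t - a n) * vector_derivative \<gamma> (at t)" for n t
  have single: "(F n has_integral 2 * pi * \<i> * branch_power L (a n) (- s)) UNIV" for n
  proof -
    have "(F n has_integral 2 * pi * \<i> * g n (a n)) UNIV"
      unfolding F_def
      by (rule Cauchy_integral_formula_unbounded_contour[OF branch contour off_cut hol a_off encloses \<epsilon> _ bound])
         (use M in auto)
    thus ?thesis using a0 by (simp add: g_def)
  qed

  obtain G where G: "G integrable_on UNIV"
    "\<And>t. norm (\<gamma> t) powr (- (1 + \<epsilon>)) * norm (vector_derivative \<gamma> (at t)) \<le> G t"
    using unbounded_contour_integrable_powr[OF contour nz, of "1 + \<epsilon>"] \<epsilon> by auto
  have F_le: "norm (F n t) \<le> norm (a n) powr (- p) * (M * G t)" for n t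
  proof -
    have "norm (F n t) \<le> (M * norm (a n) powr (- p) * norm (\<gamma> t) powr (- 1 - \<epsilon>)) * norm (vector_derivative \<gamma> (at t))"
      unfolding F_def norm_mult[of "_ / _"] using off by (intro mult_right_mono bound) auto
    also have "\<dots> = norm (a n) powr (- p) * (M * (norm (\<gamma> t) powr (- (1 + \<epsilon>)) * norm (vector_derivative \<gamma> (at t))))" by simp
    also have "\<dots> \<le> norm (a n) powr (- p) * (M * G t)" using G(2) M by (intro mult_left_mono) auto
    finally show ?thesis .
  qed
  have G0: "0 \<le> M * G t" for t
    using M G(2)[of t] by (intro mult_nonneg_nonneg order_trans[OF _ G(2)]) auto

  define A where "A = (\<Sum>n. norm (a n) powr (- p))"
  define D where "D t = branch_power L (\<gamma> t) (- s) * (deriv H (\<gamma> t) / H (\<gamma> t)) * vector_derivative \<gamma> (at t)" for t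
  have F_sums: "(\<lambda>n. F n t) sums D t" for t
  proof -
    have "\<gamma> t \<notin> range a" using a_off(2) by (metis rangeE rangeI)
    hence "(\<lambda>n. (\<gamma> t / a n) ^ m / (\<gamma> t - a n)) sums (deriv H (\<gamma> t) / H (\<gamma> t))"
      unfolding H k' by (intro logderiv_canonical_product a0 a_lim summ_k)
    from sums_mult2[OF sums_mult[OF this, of "branch_power L (\<gamma> t) (- s)"], of "vector_derivative \<gamma> (at t)"]
    show ?thesis by (simp add: F_def D_def g_def)
  qed
  have partial: "((\<lambda>t. \<Sum>n<N. F n t) has_integral (\<Sum>n<N. 2 * pi * \<i> * branch_power L (a n) (- s))) UNIV" for N
    by (intro has_integral_sum single) auto
  have partial_le: "norm (\<Sum>n<N. F n t) \<le> A * (M * G t)" for N t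
  proof -
    have "norm (\<Sum>n<N. F n t) \<le> (\<Sum>n<N. norm (a n) powr (- p) * (M * G t))"
      by (rule sum_norm_le) (rule F_le)
    also have "\<dots> = (\<Sum>n<N. norm (a n) powr (- p)) * (M * G t)" by (simp only: sum_distrib_right)
    also have "\<dots> \<le> A * (M * G t)"
      unfolding A_def by (intro mult_right_mono sum_le_suminf summ G0) auto
    finally show ?thesis .
  qed
  have AMG: "(\<lambda>t. A * (M * G t)) integrable_on UNIV" using G(1) by (intro integrable_on_mult_right)
  note conv = dominated_convergence[of "\<lambda>N t. \<Sum>n<N. F n t" UNIV, OF has_integral_integrable[OF partial]
      AMG partial_le F_sums[unfolded sums_def]]
  have "(\<lambda>n. 2 * pi * \<i> * branch_power L (a n) (- s)) sums integral UNIV D"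
    using conv(2) unfolding sums_def integral_unique[OF partial] .
  from sums_mult[OF this, of "1 / (2 * of_real pi * \<i>)"]
  have "(\<lambda>n. branch_power L (a n) (- s)) sums (1 / (2 * of_real pi * \<i>) * integral UNIV D)"
    by simp
  hence "zeta_seq L a s = 1 / (2 * of_real pi * \<i>) * integral UNIV D"
    unfolding zeta_seq_def by (rule sums_unique[symmetric])
  moreover have "has_line_integral (\<lambda>z. branch_power L z (- s) * (deriv H z / H z)) (integral UNIV D) \<gamma>"
    unfolding has_line_integral_def D_def[symmetric] using conv(1) by (rule integrable_integral)
  ultimately show ?thesis by blast
qed

end
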